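(* Let $G=K_{n_1,\dots,n_l}$ be the complete multipartite graph with parts $V_1,\dots,V_l$, $|V_p|=n_p\ge 1$. The number of travel groupoids on $G$ is equal to $$\prod_{p=1}^{l}\left(\sum_{S_p=n_p-1}\binom{n_p-1}{m_{1,1},\dots,m_{p-1,n_{p-1}},m_{p+1,1},\dots,m_{l,n_l}}\right)^{n_p},$$ where, for each $p$, the lower indices are all $m_{q,j}$ with $q\in\{1,\dots,l\}\setminus\{p\}$ and $1\le j\le n_q$, the sum runs over all families of nonnegative integers $(m_{q,j})$ with $S_p=n_p-1$, and $$S_p=m_{1,1}+\cdots+m_{p-1,n_{p-1}}+m_{p+1,1}+\cdots+m_{l,n_l}=\sum_{q\ne p}\sum_{j=1}^{n_q}m_{q,j}.$$
   Context: A groupoid $(V,* )$ is a nonempty set $V$ with a binary operation $*:V\times V\to V$. It is a travel groupoid if (t1) $(u*v)*u=u$ for all $u,v\in V$, and (t2) for all $u,v\in V$, if $(u*v)*v=u$ then $u=v$. The associated graph $G_V$ of a travel groupoid has vertex set $V$ and edge set $\{\{u,v\} : u,v\in V,\ u\neq u*v=v\}$; $(V,* )$ is said to be on a graph $G$ if $G=G_V$ (equality of graphs on the vertex set $V=V(G)$, so one counts binary operations on $V(G)$). Graphs are finite, undirected, with no multiple edges or loops. $K_{n_1,\dots,n_l}$ is the graph whose vertex set is partitioned into independent sets $V_1,\dots,V_l$ with $|V_i|=n_i\geq 1$, with an edge between every pair of vertices from different parts. The multinomial coefficient is $\binom{n}{a_1,\dots,a_k}=\frac{n!}{a_1!\cdots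 a_k!}$. *)

theory Defs
  imports "HOL-Library.FuncSet" "HOL-Library.Disjoint_Sets" Complex_Main
begin

section \<open>Graphs\<close>

type_synonym 'a graph = "'a set \<times> 'a set set"

abbreviation verts :: "'a graph \<Rightarrow> 'a set" where "verts G \<equiv> fst G"
abbreviation edges :: "'a graph \<Rightarrow> 'a set set" where "edges G \<equiv> snd G"

definition simple_graph :: "'a graph \<Rightarrow> bool" where
  "simple_graph G \<longleftrightarrow>
     finite (verts G) \<and> (\<forall>e\<in>edges G. \<exists>u\<in>verts G. \<exists>v\<in>verts G. u \<noteq> v \<and> e = {u, v})"

text \<open>The parts are \<open>P 1, \<dots>, P l\<close>, of sizes \<open>n 1, \<dots>, n l\<close>.\<close>

definition complete_multipartite ::
  "'a graph \<Rightarrow> nat \<Rightarrow> (nat \<Rightarrow> nat) \<Rightarrow> (nat \<Rightarrow> 'a set) \<Rightarrow> bool" where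
  "complete_multipartite G l n P \<longleftrightarrow>
     simple_graph G \<and>
     verts G = (\<Union>p\<in>{1..l}. P p) \<and>
     disjoint_family_on P {1..l} \<and>
     (\<forall>p\<in>{1..l}. card (P p) = n p \<and> n p \<ge> 1) \<and>
     (\<forall>p\<in>{1..l}. \<forall>u\<in>P p. \<forall>v\<in>P p. {u, v} \<notin> edges G) \<and>
     (\<forall>p\<in>{1..l}. \<forall>q\<in>{1..l}. p \<noteq> q \<longrightarrow> (\<forall>u\<in>P p. \<forall>v\<in>P q. {u, v} \<in> edges G))"

section \<open>Travel groupoids\<close>

definition groupoid :: "'a set \<Rightarrow> ('a \<Rightarrow> 'a \<Rightarrow> 'a) \<Rightarrow> bool" where
  "groupoid V f \<longleftrightarrow> V \<noteq> {} \<and> (\<forall>u\<in>V. \<forall>v\<in>V. f u v \<in> V)"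

definition travel_groupoid :: "'a set \<Rightarrow> ('a \<Rightarrow> 'a \<Rightarrow> 'a) \<Rightarrow> bool" where
  "travel_groupoid V f \<longleftrightarrow>
     groupoid V f \<and>
     (\<forall>u\<in>V. \<forall>v\<in>V. f (f u v) u = u) \<and>
     (\<forall>u\<in>V. \<forall>v\<in>V. f (f u v) v = u \<longrightarrow> u = v)"

definition groupoid_graph :: "'a set \<Rightarrow> ('a \<Rightarrow> 'a \<Rightarrow> 'a) \<Rightarrow> 'a graph" where
  "groupoid_graph V f = (V, {{u, v} | u v. u \<in> V \<and> v \<in> V \<and> u \<noteq> f u v \<and> f u v = v})"

text \<open>
  The operations are taken extensional (\<open>undefined\<close> outside the vertex set), so that each
  binary operation on the vertex set is represented by exactly one HOL function.
\<close>

definition travel_groupoids_on :: "'a graph \<Rightarrow> ('a \<Rightarrow> 'a \<Rightarrow> 'a) set" where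
  "travel_groupoids_on G =
     {f \<in> verts G \<rightarrow>\<^sub>E (verts G \<rightarrow>\<^sub>E verts G).
        travel_groupoid (verts G) f \<and> G = groupoid_graph (verts G) f}"

section \<open>Multinomial coefficients\<close>

text \<open>
  The lower indices are the values \<open>m i\<close> for \<open>i \<in> I\<close>. The division is exact
  whenever they sum to \<open>N\<close>; see \<open>prod_fact_dvd_fact_sum\<close>.
\<close>

definition multinomial :: "nat \<Rightarrow> 'i set \<Rightarrow> ('i \<Rightarrow> nat) \<Rightarrow> nat" where
  "multinomial N I m = fact N div (\<Prod>i\<in>I. fact (m i))"

lemma prod_fact_dvd_fact_sum:
  fixes m :: "'i \<Rightarrow> nat"
  assumes "finite I"
  shows "(\<Prod>i\<in>I. fact (m i) :: nat) dvd fact (\<Sum>i\<in>I. m i)"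
  using assms
proof (induction I rule: finite_induct)
  case (insert x F)
  then have "fact (m x) * (\<Prod>i\<in>F. fact (m i) :: nat) dvd fact (m x) * fact (\<Sum>i\<in>F. m i)"
    by (simp add: mult_dvd_mono)
  also have "\<dots> dvd fact (m x + (\<Sum>i\<in>F. m i))"
    by (rule fact_fact_dvd_fact)
  finally show ?case
    using insert.hyps by simp
qed simp

text \<open>The index set \<open>{(q, j). q \<in> {1..l} - {p}, 1 \<le> j \<le> n q}\<close> of the families \<open>m\<^sub>q\<^sub>,\<^sub>j\<close>.\<close>

definition other_indices :: "nat \<Rightarrow> (nat \<Rightarrow> nat) \<Rightarrow> nat \<Rightarrow> (nat \<times> nat) set" where
  "other_indices l n p = (SIGMA q:{1..l} - {p}. {1..n q})"

text \<open>
  Families are again extensional, so that each is counted once; since their values are bounded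
  by \<open>s\<close>, there are finitely many.
\<close>

definition families_of_sum :: "'i set \<Rightarrow> nat \<Rightarrow> ('i \<Rightarrow> nat) set" where
  "families_of_sum I s = {m \<in> I \<rightarrow>\<^sub>E UNIV. (\<Sum>i\<in>I. m i) = s}"

lemma finite_families_of_sum:
  assumes "finite I"
  shows "finite (families_of_sum I s)"
proof (rule finite_subset)
  show "families_of_sum I s \<subseteq> I \<rightarrow>\<^sub>E {..s}"
    using assms by (auto simp: families_of_sum_def PiE_iff extensional_def intro: member_le_sum)
  show "finite (I \<rightarrow>\<^sub>E {..s})"
    using assms by (simp add: finite_PiE)
qed

end

theory Submission
  imports Defs
begin

text \<open>
  In a travel groupoid on a graph, \<open>u * u = u\<close>, \<open>u * v = v\<close> for adjacent \<open>u\<close>, \<open>v\<close>, and otherwise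
  \<open>u * v\<close> is some neighbour of \<open>u\<close>. For a complete multipartite graph this necessary condition is
  also sufficient, because a neighbour of \<open>u\<close> is adjacent to every vertex of the part of \<open>u\<close>. So
  each ordered pair of distinct vertices in part \<open>p\<close> contributes an independent factor
  \<open>d = \<Sum>q\<noteq>p. n q\<close>, and the sum of the multinomial coefficients is \<open>d ^ (n p - 1)\<close> by
  the multinomial theorem.
\<close>

section \<open>Multinomial sums: the multinomial theorem with all variables equal to 1\<close>

lemma multinomial_insert:
  assumes "finite I" "i \<notin> I" "(\<Sum>j\<in>I. m j) = s - k" "k \<le> s"
  shows "multinomial s (insert i I) (m(i := k)) = (s choose k) * multinomial (s - k) I m"
proof -
  let ?d = "\<Prod>j\<in>I. fact (m j) :: nat"
  have "(\<Prod>j\<in>I. fact ((m(i := k)) j) :: nat) = ?d"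
    using assms(2) by (intro prod.cong) auto
  then have "multinomial s (insert i I) (m(i := k)) = fact s div (fact k * ?d)"
    using assms(1,2) by (simp add: multinomial_def)
  \<comment> \<open>Division on \<open>nat\<close> truncates, so both quotients are handled through
    the exact cofactor \<open>c\<close>, which is \<open>multinomial (s - k) I m\<close>.\<close>
  moreover obtain c where c: "fact (s - k) = ?d * c"
    using prod_fact_dvd_fact_sum[OF assms(1), of m] assms(3) by (auto elim: dvdE)
  moreover have "fact s = fact k * ?d * ((s choose k) * c)"
    using binomial_fact_lemma[OF assms(4)] c by (simp add: ac_simps)
  moreover have "?d > 0"
    by (simp add: prod_pos)
  ultimately show ?thesis
    by (simp add: multinomial_def)
qed

text \<open>Sorting families by their value \<open>k\<close> at the new index turns the sum over
  families into a double sum. The inverse resets that value to \<open>undefined\<close> to stay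
  extensional on \<open>I\<close>.\<close>

lemma families_of_sum_insert:
  assumes "finite I" "i \<notin> I"
  shows "bij_betw (\<lambda>(k, m). m(i := k)) (SIGMA k:{..s}. families_of_sum I (s - k))
           (families_of_sum (insert i I) s)"
proof (rule bij_betw_byWitness[where f' = "\<lambda>m. (m i, m(i := undefined))"])
  have sum_upd: "(\<Sum>j\<in>I. if j = i then k else m j) = (\<Sum>j\<in>I. m j)" for m :: "'a \<Rightarrow> nat" and k
    using assms(2) by (intro sum.cong) auto
  show "\<forall>a\<in>SIGMA k:{..s}. families_of_sum I (s - k).
      (\<lambda>m. (m i, m(i := undefined))) ((\<lambda>(k, m). m(i := k)) a) = a"
    using assms(2) by (auto simp: families_of_sum_def PiE_iff extensional_def fun_eq_iff)
  show "\<forall>m\<in>families_of_sum (insert i I) s.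
      (\<lambda>(k, m). m(i := k)) ((\<lambda>m. (m i, m(i := undefined))) m) = m"
    by auto
  show "(\<lambda>(k, m). m(i := k)) ` (SIGMA k:{..s}. families_of_sum I (s - k))
      \<subseteq> families_of_sum (insert i I) s"
    using assms by (auto simp: families_of_sum_def PiE_iff extensional_def sum_upd)
  show "(\<lambda>m. (m i, m(i := undefined))) ` families_of_sum (insert i I) s
      \<subseteq> (SIGMA k:{..s}. families_of_sum I (s - k))"
    using assms by (auto simp: families_of_sum_def PiE_iff extensional_def sum_upd)
qed

text \<open>By induction on \<open>I\<close>: sorting by the value at the new index leaves the
  binomial expansion of \<open>(1 + card I) ^ s\<close>.\<close>

lemma sum_multinomial:
  assumes "finite I"
  shows "(\<Sum>m\<in>families_of_sum I s. multinomial s I m) = card I ^ s"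
  using assms
proof (induction I arbitrary: s rule: finite_induct)
  case empty
  \<comment> \<open>Only \<open>s = 0\<close> admits a family, in agreement with
    \<open>0 ^ s\<close>, where \<open>0 ^ 0 = 1\<close>.\<close>
  have "families_of_sum ({} :: 'a set) s = (if s = 0 then {\<lambda>_. undefined} else {})"
    by (auto simp: families_of_sum_def)
  then show ?case
    by (simp add: multinomial_def)
next
  case (insert i I)
  have "(\<Sum>m\<in>families_of_sum (insert i I) s. multinomial s (insert i I) m)
      = (\<Sum>(k, m)\<in>(SIGMA k:{..s}. families_of_sum I (s - k)).
           multinomial s (insert i I) (m(i := k)))"
    by (subst sum.reindex_bij_betw[OF families_of_sum_insert[OF insert.hyps], symmetric])
      (simp add: case_prod_unfold)
  also have "\<dots> = (\<Sum>(k, m)\<in>(SIGMA k:{..s}. families_of_sum I (s - k)).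
           (s choose k) * multinomial (s - k) I m)"
    using insert.hyps by (intro sum.cong) (auto simp: families_of_sum_def multinomial_insert)
  also have "\<dots> = (\<Sum>k\<le>s. (s choose k) * card I ^ (s - k))"
    using insert.hyps insert.IH
    by (subst sum.Sigma[symmetric])
      (auto simp: finite_families_of_sum sum_distrib_left[symmetric])
  also have "\<dots> = (1 + card I) ^ s"
    using binomial[of 1 "card I" s] by simp
  finally show ?case
    using insert.hyps by simp
qed

section \<open>Identities valid in every travel groupoid\<close>

lemma travel_groupoid_idem:
  assumes "travel_groupoid V f" "u \<in> V"
  shows "f u u = u"
proof -
  have w: "f u u \<in> V" and "f (f u u) u = u"
    using assms by (auto simp: travel_groupoid_def groupoid_def)
  \<comment> \<open>With \<open>w = f u u\<close> this reads \<open>f (f w u) u = w\<close>, so the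
    second law forces \<open>w = u\<close>.\<close>
  then have "f (f (f u u) u) u = f u u"
    by simp
  then show ?thesis
    using assms w unfolding travel_groupoid_def by blast
qed

lemma travel_groupoid_eq_left:
  assumes "travel_groupoid V f" "u \<in> V" "v \<in> V" "f u v = u"
  shows "u = v"
  using assms by (metis travel_groupoid_def)

text \<open>Put \<open>w = f u v\<close>. The first law gives \<open>f w u = u\<close>, and applied
  to \<open>w\<close>, \<open>u\<close> it gives \<open>f (f w u) w = w\<close>.\<close>

lemma travel_groupoid_step:
  assumes "travel_groupoid V f" "u \<in> V" "v \<in> V"
  shows "f u (f u v) = f u v"
  using assms by (metis travel_groupoid_def groupoid_def)

lemma travel_groupoid_edge_iff:
  assumes "travel_groupoid V f"
  shows "{u, v} \<in> edges (groupoid_graph V f) \<longleftrightarrow> u \<in> V \<and> v \<in> V \<and> u \<noteq> v \<and> f u v = v"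
proof -
  \<comment> \<open>An unordered pair does not record which endpoint acts on the left, so the edge
    condition must be symmetric.\<close>
  have "f v u = u" if "u \<in> V" "v \<in> V" "f u v = v" for u v
    using assms that by (metis travel_groupoid_def)
  then show ?thesis
    unfolding groupoid_graph_def snd_conv mem_Collect_eq doubleton_eq_iff by metis
qed

definition neighbours :: "'a graph \<Rightarrow> 'a \<Rightarrow> 'a set" where
  "neighbours G u = {w \<in> verts G. {u, w} \<in> edges G}"

text \<open>Recording forced values as singletons makes the candidate operations a dependent
  product, so counting them means multiplying cardinalities.\<close>

definition travel_choices :: "'a graph \<Rightarrow> 'a \<Rightarrow> 'a \<Rightarrow> 'a set" where
  "travel_choices G u v = (if u = v \<or> v \<in> neighbours G u then {v} else neighbours G u)"

text \<open>This inclusion holds for every graph: for distinct \<open>u\<close>, \<open>v\<close>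
  the vertex \<open>w = f u v\<close> differs from \<open>u\<close> and satisfies
  \<open>f u w = w\<close>, hence is a neighbour of \<open>u\<close>.\<close>

lemma travel_groupoids_on_subset:
  "travel_groupoids_on G \<subseteq> (\<Pi>\<^sub>E u\<in>verts G. \<Pi>\<^sub>E v\<in>verts G. travel_choices G u v)"
proof
  fix f assume f: "f \<in> travel_groupoids_on G"
  define V where "V = verts G"
  have tg: "travel_groupoid V f" and G: "G = groupoid_graph V f"
    and ext: "f \<in> V \<rightarrow>\<^sub>E (V \<rightarrow>\<^sub>E V)"
    using f by (auto simp: travel_groupoids_on_def V_def)
  have nb: "w \<in> neighbours G u \<longleftrightarrow> u \<in> V \<and> w \<in> V \<and> u \<noteq> w \<and> f u w = w" for u w
    using travel_groupoid_edge_iff[OF tg, of u w, folded G] by (auto simp: neighbours_def V_def)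
  have "f u v \<in> travel_choices G u v" if uv: "u \<in> V" "v \<in> V" for u v
  proof -
    have "f u v \<in> V"
      using ext uv by auto
    moreover have "f u v \<noteq> u" if "u \<noteq> v"
      using travel_groupoid_eq_left[OF tg] uv that by metis
    ultimately show ?thesis
      using uv travel_groupoid_idem[OF tg] travel_groupoid_step[OF tg]
      by (auto simp: travel_choices_def nb)
  qed
  then show "f \<in> (\<Pi>\<^sub>E u\<in>verts G. \<Pi>\<^sub>E v\<in>verts G. travel_choices G u v)"
    using ext unfolding V_def[symmetric] by (auto simp: PiE_iff)
qed

section \<open>Travel groupoids on a complete multipartite graph\<close>

context
  fixes G :: "'a graph" and l :: nat and n :: "nat \<Rightarrow> nat" and V :: "nat \<Rightarrow> 'a set"
  assumes G: "complete_multipartite G l n V"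
begin

lemma verts_multipartite: "verts G = (\<Union>p\<in>{1..l}. V p)"
  using G by (simp add: complete_multipartite_def)

lemma finite_verts_multipartite: "finite (verts G)"
  using G unfolding complete_multipartite_def simple_graph_def by blast

lemma part_disjoint: "p \<in> {1..l} \<Longrightarrow> q \<in> {1..l} \<Longrightarrow> p \<noteq> q \<Longrightarrow> V p \<inter> V q = {}"
  using G by (simp add: complete_multipartite_def disjoint_family_on_def)

lemma part_card: "p \<in> {1..l} \<Longrightarrow> card (V p) = n p" and part_pos: "p \<in> {1..l} \<Longrightarrow> n p \<ge> 1"
  using G by (auto simp: complete_multipartite_def)

lemma part_finite: "p \<in> {1..l} \<Longrightarrow> finite (V p)"
  by (rule finite_subset[OF _ finite_verts_multipartite]) (auto simp: verts_multipartite)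

lemma neighbours_multipartite:
  assumes "p \<in> {1..l}" "u \<in> V p"
  shows "neighbours G u = (\<Union>q\<in>{1..l} - {p}. V q)"
proof -
  have "{u, w} \<in> edges G \<longleftrightarrow> q \<noteq> p" if "q \<in> {1..l}" "w \<in> V q" for q w
    using G assms that unfolding complete_multipartite_def by metis
  then show ?thesis
    unfolding neighbours_def verts_multipartite by blast
qed

lemma edges_multipartite:
  "edges G = {{u, v} |u v. u \<in> verts G \<and> v \<in> neighbours G u}"
proof -
  have "simple_graph G"
    using G by (simp add: complete_multipartite_def)
  then have "\<exists>u\<in>verts G. \<exists>v\<in>verts G. e = {u, v}" if "e \<in> edges G" for e
    using that unfolding simple_graph_def by blast
  then show ?thesis
    unfolding neighbours_def by blast
qed

lemma travel_groupoids_on_multipartite: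
  assumes "l \<ge> 1"
  shows "travel_groupoids_on G = (\<Pi>\<^sub>E u\<in>verts G. \<Pi>\<^sub>E v\<in>verts G. travel_choices G u v)"
proof (rule antisym[OF travel_groupoids_on_subset], rule subsetI)
  fix f assume f: "f \<in> (\<Pi>\<^sub>E u\<in>verts G. \<Pi>\<^sub>E v\<in>verts G. travel_choices G u v)"
  have nsub: "neighbours G u \<subseteq> verts G" for u
    by (auto simp: neighbours_def)
  have irrefl: "u \<notin> neighbours G u" for u
    using G nsub[of u] unfolding neighbours_def complete_multipartite_def by blast
  have sym: "v \<in> neighbours G u \<longleftrightarrow> u \<in> neighbours G v" if "u \<in> verts G" "v \<in> verts G" for u v
    using that by (auto simp: neighbours_def insert_commute)
  \<comment> \<open>Here the multipartite structure enters: a vertex not adjacent to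
    \<open>u\<close> shares its part, so any neighbour of \<open>u\<close> is adjacent to it
    too.\<close>
  have trans: "v \<in> neighbours G w"
    if "u \<in> verts G" "v \<in> verts G" "v \<notin> neighbours G u" "w \<in> neighbours G u" for u v w
  proof -
    obtain p q where p: "p \<in> {1..l}" "u \<in> V p" and q: "q \<in> {1..l}" "v \<in> V q"
      using \<open>u \<in> verts G\<close> \<open>v \<in> verts G\<close> unfolding verts_multipartite by blast
    then have "q = p"
      using \<open>v \<notin> neighbours G u\<close> neighbours_multipartite[OF p] by blast
    moreover obtain r where "r \<in> {1..l} - {p}" "w \<in> V r"
      using \<open>w \<in> neighbours G u\<close> neighbours_multipartite[OF p] by blast
    ultimately show ?thesis
      using q neighbours_multipartite[of r w] by blast
  qed
  have choice: "f u v \<in> travel_choices G u v" if "u \<in> verts G" "v \<in> verts G" for u v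
    using f that by (auto simp: PiE_iff)
  have f_adj: "f u v = v" if "u \<in> verts G" "v \<in> neighbours G u" for u v
    using choice[of u v] that nsub[of u] by (auto simp: travel_choices_def)
  have f_self: "f u u = u" if "u \<in> verts G" for u
    using choice[of u u] that by (auto simp: travel_choices_def)
  have f_nonadj: "f u v \<in> neighbours G u"
    if "u \<in> verts G" "v \<in> verts G" "u \<noteq> v" "v \<notin> neighbours G u" for u v
    using choice[of u v] that by (auto simp: travel_choices_def)
  have f_step: "f u v \<in> neighbours G u" if "u \<in> verts G" "v \<in> verts G" "u \<noteq> v" for u v
    using f_nonadj[of u v] f_adj[of u v] that by metis
  have f_verts: "f u v \<in> verts G" if "u \<in> verts G" "v \<in> verts G" for u v
    using f_step[of u v] f_self[of u] nsub[of u] that by (cases "u = v") auto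
  have "V 1 \<noteq> {}"
    using part_card[of 1] part_pos[of 1] assms by auto
  then have "verts G \<noteq> {}"
    using assms unfolding verts_multipartite by force
  then have "groupoid (verts G) f"
    using f_verts by (simp add: groupoid_def)
  moreover have "f (f u v) u = u" if "u \<in> verts G" "v \<in> verts G" for u v
  proof (cases "u = v")
    case True
    then show ?thesis
      using that f_self by simp
  next
    case False
    then show ?thesis
      using that f_step f_adj f_verts sym by metis
  qed
  \<comment> \<open>Stronger than the second law: every vertex is reached from any other in at most
    two steps.\<close>
  moreover have "f (f u v) v = v" if "u \<in> verts G" "v \<in> verts G" for u v
  proof (cases "u = v \<or> v \<in> neighbours G u")
    case True
    then show ?thesis
      using that f_self f_adj by metis
  next
    case False
    then have "f u v \<in> neighbours G u"
      using that f_nonadj by metis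
    then have "v \<in> neighbours G (f u v)"
      using that False trans by metis
    then show ?thesis
      using that f_verts f_adj by metis
  qed
  ultimately have "travel_groupoid (verts G) f"
    unfolding travel_groupoid_def by metis
  moreover have "(u \<in> verts G \<and> v \<in> verts G \<and> u \<noteq> f u v \<and> f u v = v)
      \<longleftrightarrow> u \<in> verts G \<and> v \<in> neighbours G u" for u v
    using f_step f_adj irrefl nsub by (metis subsetD)
  then have "edges (groupoid_graph (verts G) f) = edges G"
    by (simp add: edges_multipartite groupoid_graph_def)
  then have "G = groupoid_graph (verts G) f"
    by (simp add: prod_eq_iff groupoid_graph_def)
  moreover have "f \<in> verts G \<rightarrow>\<^sub>E (verts G \<rightarrow>\<^sub>E verts G)"
    using f f_verts by (auto simp: PiE_iff)
  ultimately show "f \<in> travel_groupoids_on G"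
    by (simp add: travel_groupoids_on_def)
qed

text \<open>The degree of \<open>u\<close> is the number of lower indices of the multinomial
  coefficient, which links the count to the stated formula.\<close>

lemma card_neighbours_multipartite:
  assumes "p \<in> {1..l}" "u \<in> V p"
  shows "card (neighbours G u) = card (other_indices l n p)"
proof -
  have "card (neighbours G u) = (\<Sum>q\<in>{1..l} - {p}. card (V q))"
    unfolding neighbours_multipartite[OF assms]
    by (rule card_UN_disjoint) (use part_finite part_disjoint in auto)
  also have "\<dots> = (\<Sum>q\<in>{1..l} - {p}. n q)"
    by (intro sum.cong) (auto simp: part_card)
  finally show ?thesis
    by (simp add: other_indices_def)
qed

lemma prod_travel_choices:
  assumes p: "p \<in> {1..l}" and u: "u \<in> V p"
  shows "(\<Prod>v\<in>verts G. card (travel_choices G u v)) = card (other_indices l n p) ^ (n p - 1)"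
proof -
  \<comment> \<open>The arguments \<open>v\<close> at which \<open>f u v\<close> is not forced;
    there are \<open>n p - 1\<close> of them.\<close>
  let ?S = "V p - {u}"
  have "?S \<subseteq> verts G"
    using p by (auto simp: verts_multipartite)
  moreover have one: "v = u \<or> v \<in> neighbours G u" if "v \<in> verts G - ?S" for v
    using that unfolding neighbours_multipartite[OF assms] verts_multipartite by auto
  then have "card (travel_choices G u v) = 1" if "v \<in> verts G - ?S" for v
    using that by (auto simp: travel_choices_def)
  ultimately have "(\<Prod>v\<in>verts G. card (travel_choices G u v))
      = (\<Prod>v\<in>?S. card (travel_choices G u v))"
    by (intro prod.mono_neutral_right finite_verts_multipartite) auto
  also have "\<dots> = (\<Prod>v\<in>?S. card (other_indices l n p))"
  proof (rule prod.cong)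
    fix v assume v: "v \<in> ?S"
    then have "v \<notin> neighbours G u"
      using part_disjoint p unfolding neighbours_multipartite[OF assms] by blast
    then show "card (travel_choices G u v) = card (other_indices l n p)"
      using v card_neighbours_multipartite[OF assms] by (auto simp: travel_choices_def)
  qed simp
  also have "\<dots> = card (other_indices l n p) ^ (n p - 1)"
    using u p by (simp add: part_card part_finite)
  finally show ?thesis .
qed

end

theorem theorem5p2:
  fixes G :: "'a graph" and l :: nat and n :: "nat \<Rightarrow> nat" and V :: "nat \<Rightarrow> 'a set"
  assumes "l \<ge> 1"
    and "complete_multipartite G l n V"
  shows "card (travel_groupoids_on G) =
    (\<Prod>p\<in>{1..l}.
       (\<Sum>m\<in>families_of_sum (other_indices l n p) (n p - 1).
          multinomial (n p - 1) (other_indices l n p) m) ^ n p)"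
proof -
  note G = assms(2)
  have "card (travel_groupoids_on G) = (\<Prod>u\<in>verts G. \<Prod>v\<in>verts G. card (travel_choices G u v))"
    using finite_verts_multipartite[OF G]
    by (simp add: travel_groupoids_on_multipartite[OF G assms(1)] card_PiE)
  also have "\<dots> = (\<Prod>p\<in>{1..l}. \<Prod>u\<in>V p. \<Prod>v\<in>verts G. card (travel_choices G u v))"
    using part_finite[OF G] part_disjoint[OF G]
    by (subst verts_multipartite[OF G], subst prod.UNION_disjoint) auto
  \<comment> \<open>The inner exponent counts free arguments for one \<open>u\<close>, the outer one
    the choices of \<open>u\<close> in the part.\<close>
  also have "\<dots> = (\<Prod>p\<in>{1..l}. (card (other_indices l n p) ^ (n p - 1)) ^ n p)"
    using part_card[OF G] by (intro prod.cong) (simp_all add: prod_travel_choices[OF G])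
  also have "\<dots> = (\<Prod>p\<in>{1..l}.
       (\<Sum>m\<in>families_of_sum (other_indices l n p) (n p - 1).
          multinomial (n p - 1) (other_indices l n p) m) ^ n p)"
    by (simp add: sum_multinomial other_indices_def)
  finally show ?thesis .
qed

end
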